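(* Let $G$ be a group that decomposes as an extension $$1\longrightarrow K\longrightarrow G\longrightarrow Q\longrightarrow 1$$ with $Q$ finite, and let $\Theta:Q\to\mathrm{Out}(K)$ be the associated coupling. Then $G$ is icc if and only if $K$ is icc and $\Theta:Q\to\mathrm{Out}(K)$ is injective.
   Context: A group is icc if it is infinite and all of its conjugacy classes except $\{1\}$ are infinite. The coupling $\Theta$ sends $q\in Q$ to the class in $\mathrm{Out}(K)$ of the automorphism $x\mapsto gxg^{-1}$ of $K$, for any preimage $g\in G$ of $q$. *)

theory Defs
  imports "HOL-Algebra.Algebra"
begin

section \<open>Icc groups\<close>

definition conjugation :: "('a, 'm) monoid_scheme \<Rightarrow> 'a \<Rightarrow> 'a \<Rightarrow> 'a" where
  "conjugation G g = (\<lambda>h\<in>carrier G. g \<otimes>\<^bsub>G\<^esub> h \<otimes>\<^bsub>G\<^esub> inv\<^bsub>G\<^esub> g)"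

definition conjugacy_class :: "('a, 'm) monoid_scheme \<Rightarrow> 'a \<Rightarrow> 'a set" where
  "conjugacy_class G x = orbit G (conjugation G) x"

definition icc :: "('a, 'm) monoid_scheme \<Rightarrow> bool" where
  "icc G \<longleftrightarrow> infinite (carrier G) \<and>
     (\<forall>x\<in>carrier G - {\<one>\<^bsub>G\<^esub>}. infinite (conjugacy_class G x))"


section \<open>Outer automorphisms\<close>

definition Inn :: "('a, 'm) monoid_scheme \<Rightarrow> ('a \<Rightarrow> 'a) set" where
  "Inn G = conjugation G ` carrier G"

definition Out :: "('a, 'm) monoid_scheme \<Rightarrow> ('a \<Rightarrow> 'a) set monoid" where
  "Out G = AutoGroup G Mod Inn G"

lemma carrier_AutoGroup: "carrier (AutoGroup G) = auto G"
  by (simp add: AutoGroup_def)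

lemma mult_AutoGroup:
  "\<lbrakk>f \<in> auto G; g \<in> auto G\<rbrakk> \<Longrightarrow> f \<otimes>\<^bsub>AutoGroup G\<^esub> g = compose (carrier G) f g"
  by (simp add: AutoGroup_def BijGroup_def auto_def)


section \<open>Extensions and their coupling\<close>

text \<open>
  The library's \<^const>\<open>short_exact_sequence\<close> requires all the groups to have elements of the
  same type; here the three groups live on independent types.
\<close>

locale group_extension =
  K: group K + G: group G + Q: group Q
  for K :: "('k, 'x) monoid_scheme" and G :: "('g, 'y) monoid_scheme"
    and Q :: "('q, 'z) monoid_scheme" +
  fixes \<iota> :: "'k \<Rightarrow> 'g" and \<pi> :: "'g \<Rightarrow> 'q"
  assumes inj: "\<iota> \<in> mon K G"
    and surj: "\<pi> \<in> epi G Q"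
    and exact: "\<iota> ` carrier K = kernel G Q \<pi>"

text \<open>
  Conjugation by an element of \<open>G\<close>, transported to \<open>K\<close> along the injection \<open>\<iota>\<close>:
  see \<open>\<iota>_conj_kernel\<close> below.
\<close>

definition conj_kernel ::
  "('k, 'x) monoid_scheme \<Rightarrow> ('g, 'y) monoid_scheme \<Rightarrow> ('k \<Rightarrow> 'g) \<Rightarrow> 'g \<Rightarrow> 'k \<Rightarrow> 'k" where
  "conj_kernel K G \<iota> g =
     (\<lambda>x\<in>carrier K. inv_into (carrier K) \<iota> (g \<otimes>\<^bsub>G\<^esub> \<iota> x \<otimes>\<^bsub>G\<^esub> inv\<^bsub>G\<^esub> g))"

text \<open>
  The choice of the preimage is immaterial: see \<open>coupling_eq\<close> below.
\<close>

definition coupling ::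
  "('k, 'x) monoid_scheme \<Rightarrow> ('g, 'y) monoid_scheme \<Rightarrow> ('q, 'z) monoid_scheme
     \<Rightarrow> ('k \<Rightarrow> 'g) \<Rightarrow> ('g \<Rightarrow> 'q) \<Rightarrow> 'q \<Rightarrow> ('k \<Rightarrow> 'k) set" where
  "coupling K G Q \<iota> \<pi> =
     (\<lambda>q\<in>carrier Q.
        Inn K #>\<^bsub>AutoGroup K\<^esub> conj_kernel K G \<iota> (SOME g. g \<in> carrier G \<and> \<pi> g = q))"

context group_extension
begin

lemma hom_\<iota>: "group_hom K G \<iota>" and inj_\<iota>: "inj_on \<iota> (carrier K)"
  using inj by (auto simp: mon_def group_hom_def group_hom_axioms_def)

lemma hom_\<pi>: "group_hom G Q \<pi>" and surj_\<pi>: "\<pi> ` carrier G = carrier Q"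
  using surj by (auto simp: epi_def group_hom_def group_hom_axioms_def)

sublocale I: group_hom K G \<iota> by (rule hom_\<iota>)
sublocale P: group_hom G Q \<pi> by (rule hom_\<pi>)

lemma conj_in_kernel:
  assumes "g \<in> carrier G" "x \<in> carrier K"
  shows "g \<otimes>\<^bsub>G\<^esub> \<iota> x \<otimes>\<^bsub>G\<^esub> inv\<^bsub>G\<^esub> g \<in> \<iota> ` carrier K"
proof -
  have "\<iota> x \<in> kernel G Q \<pi>" using assms exact by blast
  then show ?thesis unfolding exact using assms by (simp add: kernel_def)
qed

lemma conj_kernel_closed [simp]:
  "\<lbrakk>g \<in> carrier G; x \<in> carrier K\<rbrakk> \<Longrightarrow> conj_kernel K G \<iota> g x \<in> carrier K"
  by (simp add: conj_kernel_def conj_in_kernel inv_into_into)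

lemma \<iota>_conj_kernel:
  "\<lbrakk>g \<in> carrier G; x \<in> carrier K\<rbrakk>
     \<Longrightarrow> \<iota> (conj_kernel K G \<iota> g x) = g \<otimes>\<^bsub>G\<^esub> \<iota> x \<otimes>\<^bsub>G\<^esub> inv\<^bsub>G\<^esub> g"
  by (simp add: conj_kernel_def conj_in_kernel f_inv_into_f)

lemma \<iota>_eqD: "\<lbrakk>\<iota> x = \<iota> y; x \<in> carrier K; y \<in> carrier K\<rbrakk> \<Longrightarrow> x = y"
  using inj_\<iota> by (simp add: inj_on_eq_iff)

lemma conj_kernel_mult:
  assumes "g \<in> carrier G" "h \<in> carrier G"
  shows "compose (carrier K) (conj_kernel K G \<iota> g) (conj_kernel K G \<iota> h)
           = conj_kernel K G \<iota> (g \<otimes>\<^bsub>G\<^esub> h)"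
proof (rule extensionalityI[of _ "carrier K"])
  fix x assume x: "x \<in> carrier K"
  show "compose (carrier K) (conj_kernel K G \<iota> g) (conj_kernel K G \<iota> h) x
           = conj_kernel K G \<iota> (g \<otimes>\<^bsub>G\<^esub> h) x"
    using assms x
    by (intro \<iota>_eqD) (simp_all add: compose_eq \<iota>_conj_kernel G.inv_mult_group G.m_assoc)
qed (simp_all add: compose_def conj_kernel_def)

lemma conj_kernel_one: "conj_kernel K G \<iota> \<one>\<^bsub>G\<^esub> = (\<lambda>x\<in>carrier K. x)"
proof (rule extensionalityI[of _ "carrier K"])
  fix x assume "x \<in> carrier K"
  then show "conj_kernel K G \<iota> \<one>\<^bsub>G\<^esub> x = (\<lambda>x\<in>carrier K. x) x"
    by (intro \<iota>_eqD) (simp_all add: \<iota>_conj_kernel)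
qed (simp_all add: conj_kernel_def)

lemma conj_kernel_auto:
  assumes g: "g \<in> carrier G"
  shows "conj_kernel K G \<iota> g \<in> auto K"
proof -
  have *: "conj_kernel K G \<iota> a (conj_kernel K G \<iota> b x) = x"
    if "a \<in> carrier G" "b \<in> carrier G" "a \<otimes>\<^bsub>G\<^esub> b = \<one>\<^bsub>G\<^esub>" "x \<in> carrier K" for a b x
    using fun_cong[OF conj_kernel_mult[of a b], of x] that
    by (simp add: compose_eq conj_kernel_one)
  have "bij_betw (conj_kernel K G \<iota> g) (carrier K) (carrier K)"
    by (rule bij_betw_byWitness[where f' = "conj_kernel K G \<iota> (inv\<^bsub>G\<^esub> g)"])
       (use g * in auto)
  moreover have "conj_kernel K G \<iota> g \<in> hom K K"
  proof (rule homI)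
    fix x y assume "x \<in> carrier K" "y \<in> carrier K"
    then show "conj_kernel K G \<iota> g (x \<otimes>\<^bsub>K\<^esub> y)
        = conj_kernel K G \<iota> g x \<otimes>\<^bsub>K\<^esub> conj_kernel K G \<iota> g y"
      using g by (intro \<iota>_eqD) (simp_all add: \<iota>_conj_kernel G.m_assoc G.inv_solve_left)
  qed (use g in simp)
  ultimately show ?thesis
    by (simp add: auto_def Bij_def conj_kernel_def)
qed

lemma conj_kernel_\<iota>:
  assumes "k \<in> carrier K"
  shows "conj_kernel K G \<iota> (\<iota> k) = conjugation K k"
proof (rule extensionalityI[of _ "carrier K"])
  fix x assume "x \<in> carrier K"
  with assms show "conj_kernel K G \<iota> (\<iota> k) x = conjugation K k x"
    by (intro \<iota>_eqD) (simp_all add: \<iota>_conj_kernel conjugation_def)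
qed (simp_all add: conj_kernel_def conjugation_def)

end

lemma (in group) extension_self: "group_extension G G (singleton_group ()) (\<lambda>x. x) (\<lambda>x. ())"
proof -
  interpret T: group "singleton_group ()" by simp
  show ?thesis
    by unfold_locales (auto simp: mon_def epi_def hom_def kernel_def singleton_group_def)
qed

lemma (in group) subgroup_Inn: "subgroup (Inn G) (AutoGroup G)"
  and Inn_normal: "Inn G \<lhd> AutoGroup G"
proof -
  note E = group_extension.conj_kernel_\<iota>[OF extension_self]
    group_extension.conj_kernel_auto[OF extension_self]
    group_extension.conj_kernel_mult[OF extension_self]
  interpret A: group "AutoGroup G" by (rule AutoGroup)
  have aut: "conjugation G g \<in> auto G" if "g \<in> carrier G" for g
    using E(1,2)[OF that] by simp
  have "conjugation G \<in> hom G (AutoGroup G)"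
  proof (rule homI)
    fix g h assume "g \<in> carrier G" "h \<in> carrier G"
    then show "conjugation G (g \<otimes> h) = conjugation G g \<otimes>\<^bsub>AutoGroup G\<^esub> conjugation G h"
      using E(3)[of g h] by (simp add: E(1) aut mult_AutoGroup)
  qed (simp add: aut carrier_AutoGroup)
  then have "group_hom G (AutoGroup G) (conjugation G)"
    by unfold_locales
  then show sub: "subgroup (Inn G) (AutoGroup G)"
    unfolding Inn_def by (rule group_hom.img_is_subgroup)
  show "Inn G \<lhd> AutoGroup G"
    unfolding A.normal_inv_iff
  proof (intro conjI ballI sub)
    fix f c assume f: "f \<in> carrier (AutoGroup G)" and "c \<in> Inn G"
    then obtain g where g: "g \<in> carrier G" and c: "c = conjugation G g"
      by (auto simp: Inn_def)
    have fa: "f \<in> auto G" using f by (simp add: carrier_AutoGroup)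
    then interpret f: group_hom G G f
      by (simp add: auto_def group_hom_def group_hom_axioms_def is_group)
    have "f \<otimes>\<^bsub>AutoGroup G\<^esub> c = conjugation G (f g) \<otimes>\<^bsub>AutoGroup G\<^esub> f"
    proof -
      have "compose (carrier G) f c = compose (carrier G) (conjugation G (f g)) f"
        by (rule extensionalityI[of _ "carrier G"])
           (simp_all add: compose_eq c g conjugation_def)
      then show ?thesis
        using g fa aut by (simp add: mult_AutoGroup c)
    qed
    then have "f \<otimes>\<^bsub>AutoGroup G\<^esub> c \<otimes>\<^bsub>AutoGroup G\<^esub> inv\<^bsub>AutoGroup G\<^esub> f = conjugation G (f g)"
      using f g aut[of "f g"]
      by (simp add: A.m_assoc flip: carrier_AutoGroup)
    then show "f \<otimes>\<^bsub>AutoGroup G\<^esub> c \<otimes>\<^bsub>AutoGroup G\<^esub> inv\<^bsub>AutoGroup G\<^esub> f \<in> Inn G"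
      using g by (simp add: Inn_def)
  qed
qed

lemma (in group) group_Out: "group (Out G)"
  unfolding Out_def by (rule normal.factorgroup_is_group[OF Inn_normal])

context group_extension
begin

lemma coupling_eq:
  assumes g: "g \<in> carrier G"
  shows "coupling K G Q \<iota> \<pi> (\<pi> g) = Inn K #>\<^bsub>AutoGroup K\<^esub> conj_kernel K G \<iota> g"
proof -
  interpret A: group "AutoGroup K" by (rule K.AutoGroup)
  define h where "h = (SOME h. h \<in> carrier G \<and> \<pi> h = \<pi> g)"
  have h: "h \<in> carrier G" "\<pi> h = \<pi> g"
    using someI[of "\<lambda>h. h \<in> carrier G \<and> \<pi> h = \<pi> g" g] g by (simp_all add: h_def)
  have "h \<otimes>\<^bsub>G\<^esub> inv\<^bsub>G\<^esub> g \<in> kernel G Q \<pi>"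
    using g h by (simp add: kernel_def)
  then obtain k where k: "k \<in> carrier K" "h \<otimes>\<^bsub>G\<^esub> inv\<^bsub>G\<^esub> g = \<iota> k"
    unfolding exact[symmetric] by blast
  then have "h = \<iota> k \<otimes>\<^bsub>G\<^esub> g"
    using g h by (simp add: G.inv_solve_right')
  then have "conj_kernel K G \<iota> h
      = conjugation K k \<otimes>\<^bsub>AutoGroup K\<^esub> conj_kernel K G \<iota> g"
    using g k conj_kernel_auto
    by (simp add: conj_kernel_mult conj_kernel_\<iota>[symmetric] mult_AutoGroup)
  then have "conj_kernel K G \<iota> h \<in> Inn K #>\<^bsub>AutoGroup K\<^esub> conj_kernel K G \<iota> g"
    using k by (auto simp: r_coset_def Inn_def)
  then have "Inn K #>\<^bsub>AutoGroup K\<^esub> conj_kernel K G \<iota> g = Inn K #>\<^bsub>AutoGroup K\<^esub> conj_kernel K G \<iota> h"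
    using g conj_kernel_auto K.subgroup_Inn
    by (intro A.repr_independence) (simp_all add: carrier_AutoGroup)
  then show ?thesis
    using g by (simp add: coupling_def h_def)
qed

lemma coupling_hom: "coupling K G Q \<iota> \<pi> \<in> hom Q (Out K)"
proof -
  interpret N: normal "Inn K" "AutoGroup K" by (rule K.Inn_normal)
  have pre: "\<exists>g\<in>carrier G. q = \<pi> g" if "q \<in> carrier Q" for q
    using that surj_\<pi> by blast
  show ?thesis
  proof (rule homI)
    fix q assume "q \<in> carrier Q"
    with pre show "coupling K G Q \<iota> \<pi> q \<in> carrier (Out K)"
      using conj_kernel_auto
      by (fastforce simp: coupling_eq Out_def carrier_FactGroup carrier_AutoGroup)
  next
    fix q r assume "q \<in> carrier Q" "r \<in> carrier Q"
    then obtain g h where gh: "g \<in> carrier G" "h \<in> carrier G" "q = \<pi> g" "r = \<pi> h"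
      using pre by metis
    then have "coupling K G Q \<iota> \<pi> (q \<otimes>\<^bsub>Q\<^esub> r)
        = Inn K #>\<^bsub>AutoGroup K\<^esub> conj_kernel K G \<iota> (g \<otimes>\<^bsub>G\<^esub> h)"
      by (simp add: coupling_eq flip: P.hom_mult)
    with gh show "coupling K G Q \<iota> \<pi> (q \<otimes>\<^bsub>Q\<^esub> r)
        = coupling K G Q \<iota> \<pi> q \<otimes>\<^bsub>Out K\<^esub> coupling K G Q \<iota> \<pi> r"
      using conj_kernel_auto
      by (simp add: coupling_eq Out_def FactGroup_def N.rcos_sum carrier_AutoGroup
          mult_AutoGroup conj_kernel_mult)
  qed
qed

end

end

theory Submission
  imports Defs
begin

text \<open>
  Since \<open>Q\<close> is finite, an element of \<open>G\<close> has finitely many conjugates as soon as it has finitely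
  many conjugates under \<open>K\<close>. If \<open>G\<close> is icc, then a nontrivial element of \<open>K\<close> with a finite
  class in \<open>K\<close> would have a finite class in \<open>G\<close>; and if \<open>g\<close> acts on \<open>K\<close> as an inner
  automorphism, then some \<open>k\<inverse>g\<close> centralizes \<open>K\<close>, so has a finite class and is trivial. Conversely,
  if \<open>K\<close> is icc and \<open>g\<close> has a finite class in \<open>G\<close>, then so has every \<open>k g k\<inverse> g\<inverse>\<close>, which lies in
  \<open>K\<close> and is therefore trivial; so \<open>g\<close> acts trivially on \<open>K\<close> and lies in \<open>K\<close> by injectivity of
  the coupling, hence is trivial.
\<close>

lemma (in group) conjugacy_class_eq:
  "x \<in> carrier G \<Longrightarrow> conjugacy_class G x = (\<lambda>g. g \<otimes> x \<otimes> inv g) ` carrier G"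
  by (auto simp: conjugacy_class_def orbit_def conjugation_def)

text \<open>Conjugation respects products and inverses, so a conjugate of the quotient is a quotient
  of conjugates. This is the closure property that makes the elements with finite class a subgroup,
  the FC-centre.\<close>

lemma (in group) finite_conjugacy_class_mult_inv:
  assumes x: "x \<in> carrier G" and y: "y \<in> carrier G"
    and fin: "finite (conjugacy_class G x)" "finite (conjugacy_class G y)"
  shows "finite (conjugacy_class G (x \<otimes> inv y))"
proof -
  have "g \<otimes> (x \<otimes> inv y) \<otimes> inv g = (g \<otimes> x \<otimes> inv g) \<otimes> inv (g \<otimes> y \<otimes> inv g)"
    if "g \<in> carrier G" for g
    using that x y by (simp add: inv_mult_group m_assoc inv_solve_left)
  then have "conjugacy_class G (x \<otimes> inv y)
      \<subseteq> (\<lambda>(u, v). u \<otimes> inv v) ` (conjugacy_class G x \<times> conjugacy_class G y)"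
    using x y by (auto simp: conjugacy_class_eq)
  with fin show ?thesis
    by (meson finite_SigmaI finite_imageI finite_subset)
qed

lemma (in group) conjugacy_class_conjugate:
  assumes "x \<in> carrier G" "g \<in> carrier G"
  shows "conjugacy_class G (g \<otimes> x \<otimes> inv g) \<subseteq> conjugacy_class G x"
proof -
  have "h \<otimes> (g \<otimes> x \<otimes> inv g) \<otimes> inv h = (h \<otimes> g) \<otimes> x \<otimes> inv (h \<otimes> g)"
    if "h \<in> carrier G" for h
    using that assms by (simp add: inv_mult_group m_assoc)
  with assms show ?thesis by (auto simp: conjugacy_class_eq)
qed

context group_extension
begin

text \<open>\<open>inv_into (carrier G) \<pi>\<close> selects a transversal of the cosets of the
  kernel, indexed by \<open>Q\<close>. This is how finiteness of \<open>Q\<close> enters the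
  counting arguments.\<close>

lemma kernel_cosets:
  assumes g: "g \<in> carrier G"
  obtains q k where "q \<in> carrier Q" "k \<in> carrier K" "g = inv_into (carrier G) \<pi> q \<otimes>\<^bsub>G\<^esub> \<iota> k"
proof -
  let ?t = "inv_into (carrier G) \<pi> (\<pi> g)"
  have t: "?t \<in> carrier G" "\<pi> ?t = \<pi> g"
    using g by (simp_all add: inv_into_into f_inv_into_f)
  then have "inv\<^bsub>G\<^esub> ?t \<otimes>\<^bsub>G\<^esub> g \<in> \<iota> ` carrier K"
    unfolding exact using g by (simp add: kernel_def)
  then obtain k where "k \<in> carrier K" "inv\<^bsub>G\<^esub> ?t \<otimes>\<^bsub>G\<^esub> g = \<iota> k" by auto
  with g t show thesis
    by (intro that[of "\<pi> g" k]) (simp_all add: G.inv_solve_left')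
qed

lemma finite_carrier:
  assumes "finite (carrier Q)" "finite (carrier K)"
  shows "finite (carrier G)"
proof -
  have "carrier G \<subseteq> (\<lambda>(q, k). inv_into (carrier G) \<pi> q \<otimes>\<^bsub>G\<^esub> \<iota> k) ` (carrier Q \<times> carrier K)"
    by (auto elim: kernel_cosets)
  with assms show ?thesis
    by (meson finite_SigmaI finite_imageI finite_subset)
qed

text \<open>Write the conjugating element as \<open>t k\<close> with \<open>t\<close> in the
  transversal and \<open>k\<close> from the kernel: conjugation by \<open>k\<close> lands in the
  finite set \<open>?C\<close>, and only finitely many \<open>t\<close> remain.\<close>

lemma finite_conjugacy_class_if_finite_kernel_conjugates:
  assumes Q: "finite (carrier Q)" and g: "g \<in> carrier G"
    and fin: "finite ((\<lambda>k. \<iota> k \<otimes>\<^bsub>G\<^esub> g \<otimes>\<^bsub>G\<^esub> inv\<^bsub>G\<^esub> \<iota> k) ` carrier K)" (is "finite ?C")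
  shows "finite (conjugacy_class G g)"
proof -
  let ?t = "inv_into (carrier G) \<pi>"
  have "h \<otimes>\<^bsub>G\<^esub> g \<otimes>\<^bsub>G\<^esub> inv\<^bsub>G\<^esub> h \<in> (\<lambda>(q, c). ?t q \<otimes>\<^bsub>G\<^esub> c \<otimes>\<^bsub>G\<^esub> inv\<^bsub>G\<^esub> ?t q) ` (carrier Q \<times> ?C)"
    if h: "h \<in> carrier G" for h
  proof -
    obtain q k where qk: "q \<in> carrier Q" "k \<in> carrier K" "h = ?t q \<otimes>\<^bsub>G\<^esub> \<iota> k"
      using h by (rule kernel_cosets)
    moreover have "?t q \<in> carrier G"
      using qk surj_\<pi> by (simp add: inv_into_into)
    ultimately have "h \<otimes>\<^bsub>G\<^esub> g \<otimes>\<^bsub>G\<^esub> inv\<^bsub>G\<^esub> h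
        = ?t q \<otimes>\<^bsub>G\<^esub> (\<iota> k \<otimes>\<^bsub>G\<^esub> g \<otimes>\<^bsub>G\<^esub> inv\<^bsub>G\<^esub> \<iota> k) \<otimes>\<^bsub>G\<^esub> inv\<^bsub>G\<^esub> ?t q"
      using g by (simp add: G.inv_mult_group G.m_assoc)
    with qk show ?thesis by force
  qed
  then have "conjugacy_class G g
      \<subseteq> (\<lambda>(q, c). ?t q \<otimes>\<^bsub>G\<^esub> c \<otimes>\<^bsub>G\<^esub> inv\<^bsub>G\<^esub> ?t q) ` (carrier Q \<times> ?C)"
    unfolding G.conjugacy_class_eq[OF g] by (rule image_subsetI)
  with Q fin show ?thesis
    by (meson finite_SigmaI finite_imageI finite_subset)
qed

text \<open>Links classes in \<open>K\<close> with the sets of conjugates under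
  \<open>\<iota> k\<close> that the preceding criterion takes as input.\<close>

lemma \<iota>_conjugacy_class:
  assumes "x \<in> carrier K"
  shows "\<iota> ` conjugacy_class K x = (\<lambda>k. \<iota> k \<otimes>\<^bsub>G\<^esub> \<iota> x \<otimes>\<^bsub>G\<^esub> inv\<^bsub>G\<^esub> \<iota> k) ` carrier K"
  using assms by (simp add: K.conjugacy_class_eq image_image)

lemma finite_conjugacy_class_\<iota>D:
  assumes x: "x \<in> carrier K" and fin: "finite (conjugacy_class G (\<iota> x))"
  shows "finite (conjugacy_class K x)"
proof -
  have "\<iota> ` conjugacy_class K x \<subseteq> conjugacy_class G (\<iota> x)"
    using x by (auto simp: \<iota>_conjugacy_class G.conjugacy_class_eq)
  moreover have "inj_on \<iota> (conjugacy_class K x)"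
    using inj_\<iota> x by (auto intro: inj_on_subset simp: K.conjugacy_class_eq)
  ultimately show ?thesis
    using fin by (meson finite_imageD finite_subset)
qed

lemma coupling_eq_one_iff:
  assumes g: "g \<in> carrier G"
  shows "coupling K G Q \<iota> \<pi> (\<pi> g) = \<one>\<^bsub>Out K\<^esub> \<longleftrightarrow> conj_kernel K G \<iota> g \<in> Inn K"
proof -
  interpret A: group "AutoGroup K" by (rule K.AutoGroup)
  show ?thesis
    using A.coset_join1[of "Inn K"] A.coset_join2[of _ "Inn K"] g conj_kernel_auto K.subgroup_Inn
    by (auto simp: coupling_eq Out_def carrier_AutoGroup)
qed

text \<open>The coupling is a homomorphism, so injectivity means trivial kernel; surjectivity of
  \<open>\<pi>\<close> turns elements of \<open>Q\<close> into elements of \<open>G\<close>, which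
  removes the chosen preimages. Both directions use this form.\<close>

lemma inj_on_coupling_iff:
  "inj_on (coupling K G Q \<iota> \<pi>) (carrier Q) \<longleftrightarrow>
     (\<forall>g\<in>carrier G. conj_kernel K G \<iota> g \<in> Inn K \<longrightarrow> \<pi> g = \<one>\<^bsub>Q\<^esub>)"
proof -
  interpret O: group "Out K" by (rule K.group_Out)
  interpret C: group_hom Q "Out K" "coupling K G Q \<iota> \<pi>"
    using coupling_hom by unfold_locales
  show ?thesis
    unfolding C.inj_on_one_iff unfolding surj_\<pi>[symmetric]
    by (auto simp: coupling_eq_one_iff)
qed

lemma icc_kernel_if_icc:
  assumes Q: "finite (carrier Q)" and icc: "icc G"
  shows "icc K"
  unfolding icc_def
proof (intro conjI ballI notI)
  assume "finite (carrier K)"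
  with Q icc show False by (simp add: finite_carrier icc_def)
next
  fix x assume x: "x \<in> carrier K - {\<one>\<^bsub>K\<^esub>}" and "finite (conjugacy_class K x)"
  then have "finite (conjugacy_class G (\<iota> x))"
    using Q by (intro finite_conjugacy_class_if_finite_kernel_conjugates)
      (simp_all flip: \<iota>_conjugacy_class)
  moreover have "\<iota> x \<noteq> \<one>\<^bsub>G\<^esub>"
    using x \<iota>_eqD[of x "\<one>\<^bsub>K\<^esub>"] by auto
  ultimately show False
    using icc x by (auto simp: icc_def)
qed

lemma inj_on_coupling_if_icc:
  assumes Q: "finite (carrier Q)" and icc: "icc G"
  shows "inj_on (coupling K G Q \<iota> \<pi>) (carrier Q)"
  unfolding inj_on_coupling_iff
proof (intro ballI impI)
  fix g assume g: "g \<in> carrier G" and "conj_kernel K G \<iota> g \<in> Inn K"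
  then obtain k where k: "k \<in> carrier K" and gk: "conj_kernel K G \<iota> g = conjugation K k"
    by (auto simp: Inn_def)
  \<comment> \<open>Conjugation by \<open>g\<close> and by \<open>\<iota> k\<close> agree on the
    image of \<open>K\<close>, so \<open>h\<close> centralizes that image and its only conjugate
    under it is \<open>h\<close> itself.\<close>
  define h where "h = inv\<^bsub>G\<^esub> \<iota> k \<otimes>\<^bsub>G\<^esub> g"
  have h: "h \<in> carrier G" using g k by (simp add: h_def)
  have "\<iota> x \<otimes>\<^bsub>G\<^esub> h \<otimes>\<^bsub>G\<^esub> inv\<^bsub>G\<^esub> \<iota> x = h" if x: "x \<in> carrier K" for x
  proof -
    have "g \<otimes>\<^bsub>G\<^esub> \<iota> x \<otimes>\<^bsub>G\<^esub> inv\<^bsub>G\<^esub> g = \<iota> k \<otimes>\<^bsub>G\<^esub> \<iota> x \<otimes>\<^bsub>G\<^esub> inv\<^bsub>G\<^esub> \<iota> k"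
      using g k x gk \<iota>_conj_kernel[of g x] by (simp add: conjugation_def)
    then have "g \<otimes>\<^bsub>G\<^esub> \<iota> x = \<iota> k \<otimes>\<^bsub>G\<^esub> \<iota> x \<otimes>\<^bsub>G\<^esub> inv\<^bsub>G\<^esub> \<iota> k \<otimes>\<^bsub>G\<^esub> g"
      using g k x by (simp add: G.inv_solve_right')
    then have "h \<otimes>\<^bsub>G\<^esub> \<iota> x = \<iota> x \<otimes>\<^bsub>G\<^esub> h"
      using g k x by (simp add: h_def G.m_assoc G.inv_solve_left')
    then show ?thesis
      using h x by (simp add: G.inv_solve_right')
  qed
  then have "finite (conjugacy_class G h)"
    using Q h by (intro finite_conjugacy_class_if_finite_kernel_conjugates)
      (simp_all add: image_constant_conv)
  with icc h have "h = \<one>\<^bsub>G\<^esub>" by (auto simp: icc_def)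
  then have "g = \<iota> k"
    using g k by (simp add: h_def G.inv_solve_left')
  with k have "g \<in> kernel G Q \<pi>" unfolding exact[symmetric] by blast
  then show "\<pi> g = \<one>\<^bsub>Q\<^esub>" by (simp add: kernel_def)
qed

lemma icc_if_icc_kernel:
  assumes icc: "icc K" and inj: "inj_on (coupling K G Q \<iota> \<pi>) (carrier Q)"
  shows "icc G"
  unfolding icc_def
proof (intro conjI ballI notI)
  assume "finite (carrier G)"
  then have "finite (carrier K)"
    using inj_\<iota> I.homh by (metis finite_imageD finite_subset hom_carrier)
  with icc show False by (simp add: icc_def)
next
  \<comment> \<open>Used twice: first for commutators with \<open>g\<close>, then for
    \<open>g\<close> itself once it is known to lie in the kernel.\<close>
  have trivial: "u = \<one>\<^bsub>G\<^esub>" if "u \<in> kernel G Q \<pi>" "finite (conjugacy_class G u)" for u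
  proof -
    obtain x where "x \<in> carrier K" "u = \<iota> x"
      using \<open>u \<in> kernel G Q \<pi>\<close> unfolding exact[symmetric] by blast
    with that icc show ?thesis
      by (auto simp: icc_def dest: finite_conjugacy_class_\<iota>D)
  qed
  fix g assume "g \<in> carrier G - {\<one>\<^bsub>G\<^esub>}" and fin: "finite (conjugacy_class G g)"
  then have g: "g \<in> carrier G" and "g \<noteq> \<one>\<^bsub>G\<^esub>" by auto
  have "g \<otimes>\<^bsub>G\<^esub> \<iota> x \<otimes>\<^bsub>G\<^esub> inv\<^bsub>G\<^esub> g = \<iota> x" if x: "x \<in> carrier K" for x
  proof -
    \<comment> \<open>The commutator \<open>?c\<close> times the inverse of \<open>g\<close> lies in
      the kernel because \<open>\<iota> x\<close> does, and has a finite class because it is a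
      quotient of two conjugates of \<open>g\<close>.\<close>
    let ?c = "\<iota> x \<otimes>\<^bsub>G\<^esub> g \<otimes>\<^bsub>G\<^esub> inv\<^bsub>G\<^esub> \<iota> x"
    have "\<iota> x \<in> kernel G Q \<pi>" using x exact by blast
    then have "?c \<otimes>\<^bsub>G\<^esub> inv\<^bsub>G\<^esub> g \<in> kernel G Q \<pi>"
      using g x by (simp add: kernel_def)
    moreover have "finite (conjugacy_class G (?c \<otimes>\<^bsub>G\<^esub> inv\<^bsub>G\<^esub> g))"
    proof (rule G.finite_conjugacy_class_mult_inv)
      show "finite (conjugacy_class G ?c)"
        using g x fin by (intro finite_subset[OF G.conjugacy_class_conjugate]) simp_all
    qed (use g x fin in simp_all)
    ultimately have "?c \<otimes>\<^bsub>G\<^esub> inv\<^bsub>G\<^esub> g = \<one>\<^bsub>G\<^esub>" by (rule trivial)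
    then show ?thesis
      using g x by (simp add: G.inv_solve_right')
  qed
  \<comment> \<open>Acting trivially on \<open>K\<close> means acting as the inner automorphism of
    the identity, so injectivity of the coupling applies to \<open>g\<close>.\<close>
  then have "conj_kernel K G \<iota> g = conj_kernel K G \<iota> \<one>\<^bsub>G\<^esub>"
    by (simp add: conj_kernel_def cong: restrict_cong)
  also have "\<dots> = conjugation K \<one>\<^bsub>K\<^esub>"
    using conj_kernel_\<iota>[of "\<one>\<^bsub>K\<^esub>"] by simp
  finally have "conj_kernel K G \<iota> g \<in> Inn K" by (simp add: Inn_def)
  with inj g have "g \<in> kernel G Q \<pi>"
    by (simp add: inj_on_coupling_iff kernel_def)
  then have "g = \<one>\<^bsub>G\<^esub>" using fin by (rule trivial)
  with \<open>g \<noteq> \<one>\<^bsub>G\<^esub>\<close> show False ..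
qed

end

theorem proposition5p1:
  fixes K :: "('k, 'x) monoid_scheme" and G :: "('g, 'y) monoid_scheme"
    and Q :: "('q, 'z) monoid_scheme"
    and \<iota> :: "'k \<Rightarrow> 'g" and \<pi> :: "'g \<Rightarrow> 'q"
  assumes "group_extension K G Q \<iota> \<pi>"
    and "finite (carrier Q)"
  shows "icc G \<longleftrightarrow> icc K \<and> inj_on (coupling K G Q \<iota> \<pi>) (carrier Q)"
proof -
  interpret group_extension K G Q \<iota> \<pi> by (rule assms)
  show ?thesis
    using assms(2) icc_kernel_if_icc inj_on_coupling_if_icc icc_if_icc_kernel by blast
qed

end
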